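(* Let $A\in SPD(n)$. There is $\varepsilon>0$ such that on the open ball $\mathcal B(0,\varepsilon)$ of radius $\varepsilon$ centered at $0$ in $T_ASPD(n)\cong\mathbb R^{\frac12 n(n+1)}$, the Riemannian exponential map $\exp_A:\mathcal B(0,\varepsilon)\to SPD(n)$ of the Wasserstein metric $g_W$ is given explicitly by $$\exp_A X=A+X+\Gamma_A[X]\,A\,\Gamma_A[X].$$
   Context: $SPD(n)$ is the set of real symmetric positive-definite $n\times n$ matrices, an open subset of the space $Sym(n)$ of real symmetric matrices, so $T_ASPD(n)\cong Sym(n)$. For $A\in SPD(n)$ and a real $n\times n$ matrix $X$, $\Gamma_A[X]$ denotes the unique real matrix satisfying $A\,\Gamma_A[X]+\Gamma_A[X]\,A=X$. The Wasserstein metric is the Riemannian metric $g_W|_A(X,Y)=\mathrm{tr}(\Gamma_A[Y]\,A\,\Gamma_A[X])=\frac12\mathrm{tr}(\Gamma_A[Y]X)$ for $X,Y\in T_ASPD(n)$. *)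

theory Defs
  imports "HOL-Analysis.Analysis"
begin

text \<open>
  Riemannian geometry on a relatively open subset \<open>U\<close> of a linear subspace \<open>V\<close> of a normed
  space.  Every tangent space is identified with \<open>V\<close>, so that a Riemannian metric is a map
  \<open>g p x y\<close> with base point \<open>p \<in> U\<close> and tangent vectors \<open>x, y \<in> V\<close>.
\<close>

type_synonym 'a metric_tensor = "'a \<Rightarrow> 'a \<Rightarrow> 'a \<Rightarrow> real"

definition metric_deriv ::
    "'a::real_normed_vector metric_tensor \<Rightarrow> 'a \<Rightarrow> 'a \<Rightarrow> 'a \<Rightarrow> 'a \<Rightarrow> real" where
  "metric_deriv g p z x y = deriv (\<lambda>t. g (p + t *\<^sub>R z) x y) 0"

text \<open>
  The Christoffel map of the Levi-Civita connection in the global linear chart \<open>V\<close>: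
  \<open>christoffel V g p x y\<close> is the derivative at \<open>p\<close>, in direction \<open>x\<close>, of the constant vector
  field \<open>y\<close>.  Its defining equation is Koszul's formula for constant (hence commuting) vector
  fields, the basis-free form of
  \<open>\<Gamma>\<^sup>k\<^bsub>ij\<^esub> = 1/2 g\<^sup>k\<^sup>l (\<partial>\<^sub>i g\<^bsub>jl\<^esub> + \<partial>\<^sub>j g\<^bsub>il\<^esub> - \<partial>\<^sub>l g\<^bsub>ij\<^esub>)\<close>.
\<close>

definition christoffel ::
    "'a::real_normed_vector set \<Rightarrow> 'a metric_tensor \<Rightarrow> 'a \<Rightarrow> 'a \<Rightarrow> 'a \<Rightarrow> 'a" where
  "christoffel V g p x y =
     (THE w. w \<in> V \<and>
        (\<forall>z\<in>V. g p w z =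
           (metric_deriv g p x y z + metric_deriv g p y x z - metric_deriv g p z x y) / 2))"

definition geodesic_on ::
    "'a::real_normed_vector set \<Rightarrow> 'a set \<Rightarrow> 'a metric_tensor \<Rightarrow> real set \<Rightarrow> (real \<Rightarrow> 'a) \<Rightarrow> bool" where
  "geodesic_on V U g I \<gamma> \<longleftrightarrow>
     (\<forall>t\<in>I. \<gamma> t \<in> U) \<and>
     (\<exists>v. \<forall>t\<in>I. (\<gamma> has_vector_derivative v t) (at t) \<and>
        (v has_vector_derivative - christoffel V g (\<gamma> t) (v t) (v t)) (at t))"

text \<open>
  \<open>riem_exp_rel V U g p x q\<close>: the geodesic from \<open>p\<close> with initial velocity \<open>x\<close> exists up to
  time 1 and reaches \<open>q\<close> at that time.
\<close>

definition riem_exp_rel ::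
    "'a::real_normed_vector set \<Rightarrow> 'a set \<Rightarrow> 'a metric_tensor \<Rightarrow> 'a \<Rightarrow> 'a \<Rightarrow> 'a \<Rightarrow> bool" where
  "riem_exp_rel V U g p x q \<longleftrightarrow>
     (\<exists>I \<gamma>. open I \<and> is_interval I \<and> {0, 1} \<subseteq> I \<and> geodesic_on V U g I \<gamma> \<and>
        \<gamma> 0 = p \<and> (\<gamma> has_vector_derivative x) (at 0) \<and> \<gamma> 1 = q)"

definition riem_exp_domain ::
    "'a::real_normed_vector set \<Rightarrow> 'a set \<Rightarrow> 'a metric_tensor \<Rightarrow> 'a \<Rightarrow> 'a set" where
  "riem_exp_domain V U g p = {x \<in> V. \<exists>q. riem_exp_rel V U g p x q}"

definition riem_exp ::
    "'a::real_normed_vector set \<Rightarrow> 'a set \<Rightarrow> 'a metric_tensor \<Rightarrow> 'a \<Rightarrow> 'a \<Rightarrow> 'a" where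
  "riem_exp V U g p x = (THE q. riem_exp_rel V U g p x q)"

definition Sym :: "(real ^ 'n ^ 'n) set" where
  "Sym = {A. transpose A = A}"

definition SPD :: "(real ^ 'n ^ 'n) set" where
  "SPD = {A \<in> Sym. \<forall>x. x \<noteq> 0 \<longrightarrow> 0 < x \<bullet> (A *v x)}"

definition sylv :: "real ^ 'n ^ 'n \<Rightarrow> real ^ 'n ^ 'n \<Rightarrow> real ^ 'n ^ 'n" where
  "sylv A X = (THE G. A ** G + G ** A = X)"

definition wasserstein_metric :: "(real ^ 'n ^ 'n) metric_tensor" where
  "wasserstein_metric A X Y = trace (sylv A Y ** A ** sylv A X)"

abbreviation wasserstein_exp_domain :: "real ^ 'n ^ 'n \<Rightarrow> (real ^ 'n ^ 'n) set" where
  "wasserstein_exp_domain \<equiv> riem_exp_domain Sym SPD wasserstein_metric"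

abbreviation wasserstein_exp :: "real ^ 'n ^ 'n \<Rightarrow> real ^ 'n ^ 'n \<Rightarrow> real ^ 'n ^ 'n" where
  "wasserstein_exp \<equiv> riem_exp Sym SPD wasserstein_metric"

end

theory Submission
  imports Defs
begin

text \<open>
  Differentiating the Sylvester equation and inserting the result into Koszul's formula shows
  that the Christoffel map of the Wasserstein metric is \<open>- 2 L A L\<close> on the diagonal, with
  \<open>L = sylv A V\<close>.  Along a geodesic \<open>\<gamma>\<close> the matrix \<open>L = sylv \<gamma> \<gamma>'\<close> therefore satisfies the
  Riccati equation \<open>L' = - L\<^sup>2\<close>, while \<open>\<gamma>' = L \<gamma> + \<gamma> L\<close>.  With \<open>G = sylv A X\<close>, this is solved by
  \<open>\<gamma> t = (1 + t G) A (1 + t G)\<close>, as long as \<open>1 + t G\<close> is invertible.  The difference of two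
  solutions of the Riccati equation, and then that of the two curves, solves a linear equation
  \<open>D' = P D + D Q\<close> with \<open>D 0 = 0\<close>, so the geodesic is unique by Gronwall's argument.
\<close>

section \<open>Matrix algebra: products, traces and transposes\<close>

lemma bounded_bilinear_matrix_mult:
  "bounded_bilinear ((**) :: real^'n^'m \<Rightarrow> real^'p^'n \<Rightarrow> real^'p^'m)"
proof -
  have "bilinear ((**) :: real^'n^'m \<Rightarrow> real^'p^'n \<Rightarrow> real^'p^'m)"
    unfolding bilinear_def linear_iff
    by (simp add: matrix_matrix_mult_def vec_eq_iff sum.distrib sum_distrib_left algebra_simps)
  then show ?thesis
    by (simp add: bilinear_conv_bounded_bilinear)
qed

interpretation matrix_mult: bounded_bilinear "(**) :: real^'n^'m \<Rightarrow> real^'p^'n \<Rightarrow> real^'p^'m"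
  by (rule bounded_bilinear_matrix_mult)

lemma bounded_linear_trace: "bounded_linear (trace :: real^'n^'n \<Rightarrow> real)"
  by (rule linear_conv_bounded_linear[THEN iffD1])
     (simp add: linear_iff trace_def sum.distrib sum_distrib_left)

lemma bounded_linear_transpose: "bounded_linear (transpose :: real^'n^'n \<Rightarrow> real^'n^'n)"
  by (rule linear_conv_bounded_linear[THEN iffD1])
     (simp add: linear_iff transpose_def vec_eq_iff)

lemmas trace_minus = linear_neg[OF bounded_linear.linear[OF bounded_linear_trace]]
lemmas transpose_zero = linear_0[OF bounded_linear.linear[OF bounded_linear_transpose]]
lemmas transpose_add = linear_add[OF bounded_linear.linear[OF bounded_linear_transpose]]
lemmas transpose_diff = linear_diff[OF bounded_linear.linear[OF bounded_linear_transpose]]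
lemmas transpose_minus = linear_neg[OF bounded_linear.linear[OF bounded_linear_transpose]]

lemmas matrix_ring_simps = matrix_mult.add_left matrix_mult.add_right matrix_mult.diff_left
  matrix_mult.diff_right matrix_mult.minus_left matrix_mult.minus_right
  matrix_mult.scaleR_left matrix_mult.scaleR_right matrix_mul_assoc

lemma trace_transpose: "trace (transpose M) = trace M"
  by (simp add: trace_def transpose_def)

text \<open>Each diagonal entry is the quadratic form of \<open>A\<close> at a column of
  \<open>G\<close>; this is how definiteness of \<open>A\<close> enters trace identities.\<close>

lemma trace_congruence:
  fixes A :: "real^'n^'n" and G :: "real^'m^'n"
  shows "trace (transpose G ** A ** G) = (\<Sum>j\<in>UNIV. column j G \<bullet> (A *v column j G))"
proof -
  have "trace (transpose G ** (A ** G)) = (\<Sum>j\<in>UNIV. column j G \<bullet> (A *v column j G))"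
    by (simp add: trace_def transpose_def matrix_matrix_mult_def matrix_vector_mult_def
        column_def inner_vec_def)
  then show ?thesis
    by (simp add: matrix_mul_assoc)
qed

lemma SPD_imp_Sym: "A \<in> SPD \<Longrightarrow> A \<in> Sym"
  by (simp add: SPD_def)

lemma Sym_iff: "A \<in> Sym \<longleftrightarrow> transpose A = A"
  by (simp add: Sym_def)

lemma trace_congruence_pos:
  fixes A :: "real^'n^'n" and G :: "real^'m^'n"
  assumes "A \<in> SPD" and "G \<noteq> 0"
  shows "0 < trace (transpose G ** A ** G)"
proof -
  have nonneg: "0 \<le> x \<bullet> (A *v x)" for x
    using assms(1) by (cases "x = 0") (auto simp: SPD_def less_imp_le)
  obtain j where "column j G \<noteq> 0"
    using assms(2) by (force simp: vec_eq_iff column_def)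
  then have "0 < column j G \<bullet> (A *v column j G)"
    using assms(1) by (auto simp: SPD_def)
  then show ?thesis
    unfolding trace_congruence
    by (intro sum_pos2[of _ j]) (auto simp: nonneg)
qed

section \<open>The Sylvester operator and its inverse \<open>sylv\<close>\<close>

text \<open>Regarded as a bilinear map in both arguments, so that perturbations of the base point
  \<open>A\<close> can be handled as well as linearity in \<open>G\<close>.\<close>

definition lyapunov :: "real^'n^'n \<Rightarrow> real^'n^'n \<Rightarrow> real^'n^'n" where
  "lyapunov A G = A ** G + G ** A"

interpretation lyapunov: bounded_bilinear "lyapunov :: real^'n^'n \<Rightarrow> real^'n^'n \<Rightarrow> real^'n^'n"
proof -
  have "bilinear (lyapunov :: real^'n^'n \<Rightarrow> real^'n^'n \<Rightarrow> real^'n^'n)"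
    unfolding bilinear_def linear_iff lyapunov_def
    by (simp add: matrix_ring_simps algebra_simps)
  then show "bounded_bilinear (lyapunov :: real^'n^'n \<Rightarrow> real^'n^'n \<Rightarrow> real^'n^'n)"
    by (simp add: bilinear_conv_bounded_bilinear)
qed

lemma linear_lyapunov: "linear (lyapunov A)"
  by (simp add: linear_conv_bounded_linear lyapunov.bounded_linear_right)

text \<open>Pairing a kernel element \<open>G\<close> with its transpose under the trace gives two
  congruence traces, of \<open>G\<close> and of \<open>transpose G\<close>, that sum to 0; both are
  positive unless \<open>G = 0\<close>. All of the matrix space is covered because
  \<open>sylv\<close> demands uniqueness among all matrices.\<close>

lemma inj_lyapunov_SPD:
  assumes "A \<in> SPD"
  shows "inj (lyapunov A)"
proof -
  have "G = 0" if "lyapunov A G = 0" for G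
  proof (rule ccontr)
    assume "G \<noteq> 0"
    then have "transpose G \<noteq> 0"
      by (metis transpose_zero transpose_transpose)
    have "0 = trace (transpose G ** lyapunov A G)"
      using that by (simp add: linear_0[OF bounded_linear.linear[OF bounded_linear_trace]] matrix_mult.zero_right)
    also have "\<dots> = trace (transpose G ** A ** G) + trace ((transpose G ** G) ** A)"
      by (simp add: lyapunov_def matrix_ring_simps trace_add)
    also have "trace ((transpose G ** G) ** A) = trace (transpose (transpose G) ** A ** transpose G)"
      using trace_mul_sym[of "transpose G" "G ** A"] by (simp add: matrix_mul_assoc)
    finally show False
      using trace_congruence_pos[OF assms \<open>G \<noteq> 0\<close>]
        trace_congruence_pos[OF assms \<open>transpose G \<noteq> 0\<close>] by linarith
  qed
  then show ?thesis
    by (subst linear_injective_0[OF linear_lyapunov]) blast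
qed

text \<open>The facts on \<open>sylv\<close> assume injectivity rather than membership in
  \<open>SPD\<close>, since injectivity is what the perturbation argument yields for nearby
  matrices.\<close>

lemma sylv_eqI:
  assumes "inj (lyapunov A)" and "lyapunov A G = X"
  shows "sylv A X = G"
  unfolding sylv_def lyapunov_def[symmetric]
proof (rule the_equality)
  show "G' = G" if "lyapunov A G' = X" for G'
    using injD[OF assms(1), of G' G] assms(2) that by simp
qed (rule assms)

text \<open>In finite dimension an injective endomorphism is onto, so a solution exists.\<close>

lemma lyapunov_sylv:
  assumes "inj (lyapunov A)"
  shows "lyapunov A (sylv A X) = X"
proof -
  have "surj (lyapunov A)"
    by (rule linear_injective_imp_surjective[OF linear_lyapunov assms]) simp
  then obtain G where G: "lyapunov A G = X"
    unfolding surj_def by metis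
  then show ?thesis
    using sylv_eqI[OF assms G] by simp
qed

lemma linear_sylv:
  assumes "inj (lyapunov A)"
  shows "linear (sylv A)"
  unfolding linear_iff
  by (auto intro!: sylv_eqI[OF assms] simp: lyapunov.add_right lyapunov.scaleR_right lyapunov_sylv[OF assms])

lemma transpose_lyapunov: "transpose (lyapunov A G) = lyapunov (transpose A) (transpose G)"
  by (simp add: lyapunov_def transpose_add matrix_transpose_mul add.commute)

text \<open>Transposing the Sylvester equation shows that the transposed solution solves the same
  equation, so uniqueness applies.\<close>

lemma sylv_Sym:
  assumes "inj (lyapunov A)" "A \<in> Sym" "X \<in> Sym"
  shows "sylv A X \<in> Sym"
proof -
  have "lyapunov A (transpose (sylv A X)) = X"
    using assms transpose_lyapunov[of A "sylv A X"] lyapunov_sylv[OF assms(1), of X]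
    by (simp add: Sym_iff)
  then show ?thesis
    using sylv_eqI[OF assms(1), of "transpose (sylv A X)" X] by (simp add: Sym_iff)
qed

section \<open>Continuity and differentiability of \<open>sylv\<close> in the base point\<close>

text \<open>Injectivity gives a lower bound \<open>b\<close> at \<open>A\<close>. Replacing
  \<open>A\<close> by \<open>B\<close> costs at most \<open>K * norm (B - A)\<close>, which the
  radius \<open>b / (2 * K)\<close> keeps below half of \<open>b\<close>.\<close>

lemma lyapunov_bounded_below_nhds:
  fixes A :: "real^'n^'n"
  assumes "inj (lyapunov A)"
  obtains c \<delta> where "0 < c" "0 < \<delta>"
    "\<And>B G. norm (B - A) < \<delta> \<Longrightarrow> c * norm G \<le> norm (lyapunov B G)"
proof -
  obtain b where b: "b > 0" "\<And>G. b * norm G \<le> norm (lyapunov A G)"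
    using linear_inj_bounded_below_pos[OF linear_lyapunov assms] by blast
  obtain K where K: "K > 0" "\<And>B G :: real^'n^'n. norm (lyapunov B G) \<le> norm B * norm G * K"
    using lyapunov.pos_bounded by blast
  have "b / 2 * norm G \<le> norm (lyapunov B G)" if "norm (B - A) < b / (2 * K)" for B G
  proof -
    have "norm (lyapunov (B - A) G) \<le> norm (B - A) * norm G * K"
      by (rule K)
    also have "\<dots> = (norm (B - A) * K) * norm G"
      by simp
    also have "\<dots> \<le> b / 2 * norm G"
      using that K(1) by (intro mult_right_mono) (auto simp: field_simps)
    finally have "norm (lyapunov (B - A) G) \<le> b / 2 * norm G" .
    moreover have "lyapunov A G = lyapunov B G - lyapunov (B - A) G"
      by (simp add: lyapunov.diff_left)
    then have "norm (lyapunov A G) \<le> norm (lyapunov B G) + norm (lyapunov (B - A) G)"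
      by (simp add: norm_triangle_ineq4)
    ultimately show ?thesis
      using b(2)[of G] by (simp add: field_simps)
  qed
  then show ?thesis
    using b(1) K(1) by (intro that[of "b / 2" "b / (2 * K)"]) auto
qed

lemma eventually_inj_lyapunov:
  assumes "inj (lyapunov A)" and "(a \<longlongrightarrow> A) F"
  shows "\<forall>\<^sub>F t in F. inj (lyapunov (a t))"
proof -
  obtain c \<delta> where c: "0 < c" "0 < \<delta>"
    "\<And>B G. norm (B - A) < \<delta> \<Longrightarrow> c * norm G \<le> norm (lyapunov B G)"
    using lyapunov_bounded_below_nhds[OF assms(1)] by metis
  have "inj (lyapunov B)" if "norm (B - A) < \<delta>" for B
    using c(1) c(3)[OF that]
    by (subst linear_injective_0[OF linear_lyapunov]) (metis mult_le_0_iff norm_le_zero_iff norm_zero not_le)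
  moreover have "\<forall>\<^sub>F t in F. norm (a t - A) < \<delta>"
    using tendstoD[OF assms(2) c(2)] by (simp add: dist_norm)
  ultimately show ?thesis
    by (auto elim: eventually_mono)
qed

text \<open>The error \<open>sylv (a t) (x t) - sylv A X\<close> is mapped by
  \<open>lyapunov (a t)\<close> to the residual of the limit solution. The residual tends to 0, and
  the uniform lower bound \<open>c\<close> carries this over to the error.\<close>

lemma tendsto_sylv:
  assumes inj: "inj (lyapunov A)" and a: "(a \<longlongrightarrow> A) F" and x: "(x \<longlongrightarrow> X) F"
  shows "((\<lambda>t. sylv (a t) (x t)) \<longlongrightarrow> sylv A X) F"
proof -
  obtain c \<delta> where c: "0 < c" "0 < \<delta>"
    "\<And>B G. norm (B - A) < \<delta> \<Longrightarrow> c * norm G \<le> norm (lyapunov B G)"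
    using lyapunov_bounded_below_nhds[OF inj] by metis
  let ?G = "sylv A X"
  have "((\<lambda>t. x t - lyapunov (a t) ?G) \<longlongrightarrow> X - lyapunov A ?G) F"
    by (intro tendsto_intros x lyapunov.tendsto a)
  then have lim: "((\<lambda>t. norm (x t - lyapunov (a t) ?G) / c) \<longlongrightarrow> 0) F"
    by (auto simp: lyapunov_sylv[OF inj] intro: tendsto_norm_zero tendsto_divide_zero)
  have "\<forall>\<^sub>F t in F. norm (a t - A) < \<delta>"
    using tendstoD[OF a c(2)] by (simp add: dist_norm)
  then have "\<forall>\<^sub>F t in F. norm (sylv (a t) (x t) - ?G) \<le> norm (x t - lyapunov (a t) ?G) / c"
    using eventually_inj_lyapunov[OF inj a]
  proof eventually_elim
    case (elim t)
    then show ?case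
      using c(1) c(3)[OF elim(1), of "sylv (a t) (x t) - ?G"]
      by (simp add: lyapunov.diff_right lyapunov_sylv field_simps)
  qed
  then show ?thesis
    by (intro Lim_null_comparison[THEN LIM_zero_cancel, OF _ lim])
qed

lemma has_vector_derivative_iff_quotient:
  "(f has_vector_derivative D) (at x) \<longleftrightarrow> ((\<lambda>y. (f y - f x) /\<^sub>R (y - x)) \<longlongrightarrow> D) (at x)"
proof -
  \<comment> \<open>Dividing by \<open>y - x\<close> or by its norm changes at most the sign, which
    the outer norm removes.\<close>
  have eq: "norm ((f y - f x - (y - x) *\<^sub>R D) /\<^sub>R norm (y - x)) = norm ((f y - f x) /\<^sub>R (y - x) - D)"
    if "y \<noteq> x" for y
  proof -
    have "(f y - f x) /\<^sub>R (y - x) - D = (f y - f x - (y - x) *\<^sub>R D) /\<^sub>R (y - x)"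
      using that by (simp add: scaleR_right_diff_distrib)
    then show ?thesis
      by simp
  qed
  have "(f has_vector_derivative D) (at x) \<longleftrightarrow>
      ((\<lambda>y. norm ((f y - f x - (y - x) *\<^sub>R D) /\<^sub>R norm (y - x))) \<longlongrightarrow> 0) (at x)"
    unfolding tendsto_norm_zero_iff
    by (simp add: has_vector_derivative_def has_derivative_def bounded_linear_scaleR_left Lim_ident_at)
  also have "\<dots> \<longleftrightarrow> ((\<lambda>y. norm ((f y - f x) /\<^sub>R (y - x) - D)) \<longlongrightarrow> 0) (at x)"
    by (intro tendsto_cong eventually_at_filter[THEN iffD2] always_eventually allI impI eq)
  also have "\<dots> \<longleftrightarrow> ((\<lambda>y. (f y - f x) /\<^sub>R (y - x)) \<longlongrightarrow> D) (at x)"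
    by (simp add: tendsto_norm_zero_iff LIM_zero_iff)
  finally show ?thesis .
qed

text \<open>The difference quotient of \<open>sylv (a t) (x t)\<close> solves a Sylvester equation
  with coefficient \<open>a t\<close>, so its convergence follows from the continuity of \<open>sylv\<close>.\<close>

lemma has_vector_derivative_sylv:
  assumes inj: "inj (lyapunov (a t))"
    and a: "(a has_vector_derivative a') (at t)" and x: "(x has_vector_derivative x') (at t)"
  shows "((\<lambda>s. sylv (a s) (x s)) has_vector_derivative
    sylv (a t) (x' - lyapunov a' (sylv (a t) (x t)))) (at t)"
proof -
  let ?G = "sylv (a t) (x t)"
  \<comment> \<open>Right-hand side for the difference quotient: subtract the Sylvester equations at
    \<open>s\<close> and \<open>t\<close>, move the change of \<open>a\<close> to the right, and
    divide by \<open>s - t\<close>.\<close>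
  let ?R = "\<lambda>s. (x s - x t) /\<^sub>R (s - t) - lyapunov ((a s - a t) /\<^sub>R (s - t)) ?G"
  have cont: "(a \<longlongrightarrow> a t) (at t)"
    using a has_vector_derivative_continuous isCont_def by blast
  have "((\<lambda>s. sylv (a s) (?R s)) \<longlongrightarrow> sylv (a t) (x' - lyapunov a' ?G)) (at t)"
    by (intro tendsto_sylv inj cont tendsto_diff lyapunov.tendsto tendsto_const
        a[unfolded has_vector_derivative_iff_quotient] x[unfolded has_vector_derivative_iff_quotient])
  moreover have "\<forall>\<^sub>F s in at t. sylv (a s) (?R s) = (sylv (a s) (x s) - ?G) /\<^sub>R (s - t)"
    using eventually_inj_lyapunov[OF inj cont]
  proof eventually_elim
    case (elim s)
    show ?case
      by (rule sylv_eqI[OF elim])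
        (simp add: lyapunov.diff_right lyapunov.diff_left lyapunov.scaleR_right lyapunov.scaleR_left
          lyapunov_sylv[OF elim] lyapunov_sylv[OF inj] algebra_simps)
  qed
  ultimately show ?thesis
    unfolding has_vector_derivative_iff_quotient by (rule Lim_transform_eventually)
qed

section \<open>The Wasserstein metric and its Christoffel map\<close>

text \<open>Transposition and cyclicity give tr(QAP) = tr(QPA), so twice the metric is tr(Q(AP +
  PA)) = tr(QX). In this form only one factor depends on the base point, which eases
  differentiation.\<close>

lemma wasserstein_metric_eq_trace:
  assumes "inj (lyapunov A)" "A \<in> Sym" "X \<in> Sym" "Y \<in> Sym"
  shows "wasserstein_metric A X Y = trace (sylv A Y ** X) / 2"
proof -
  let ?P = "sylv A X" and ?Q = "sylv A Y"
  have sym: "transpose A = A" "transpose ?P = ?P" "transpose ?Q = ?Q"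
    using assms sylv_Sym[of A] by (auto simp: Sym_iff)
  have "trace (?Q ** A ** ?P) = trace (?P ** (A ** ?Q))"
    using trace_transpose[of "?Q ** A ** ?P"] by (simp add: matrix_transpose_mul sym)
  also have "\<dots> = trace (?Q ** ?P ** A)"
    using trace_mul_sym[of "?P ** A" ?Q] by (simp add: matrix_mul_assoc)
  finally have "2 * trace (?Q ** A ** ?P) = trace (?Q ** lyapunov A ?P)"
    by (simp add: lyapunov_def matrix_ring_simps trace_add)
  then show ?thesis
    by (simp add: lyapunov_sylv[OF assms(1)] wasserstein_metric_def)
qed

text \<open>Self-adjointness of the Sylvester operator for the trace pairing, by cyclicity.\<close>

lemma trace_lyapunov_swap: "trace (P ** lyapunov A Q) = trace (lyapunov A P ** Q)"
  for A :: "real^'n^'n"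
  using trace_mul_sym[of A "P ** Q"] by (simp add: lyapunov_def matrix_ring_simps trace_add)

text \<open>In the one-factor trace formula the derivative falls on
  \<open>sylv (A + t *\<^sub>R Z) Y\<close>; self-adjointness then moves the outer
  \<open>sylv A\<close> onto \<open>X\<close>.\<close>

lemma metric_deriv_wasserstein:
  assumes A: "A \<in> SPD" and Z: "Z \<in> Sym" and X: "X \<in> Sym" and Y: "Y \<in> Sym"
  shows "metric_deriv wasserstein_metric A Z X Y
    = - trace (lyapunov Z (sylv A Y) ** sylv A X) / 2"
proof -
  note inj = inj_lyapunov_SPD[OF A]
  let ?a = "\<lambda>t. A + t *\<^sub>R Z" and ?L = "lyapunov Z (sylv A Y)"
  have a: "(?a has_vector_derivative Z) (at 0)"
    by (auto intro!: derivative_eq_intros)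
  have "((\<lambda>t. sylv (?a t) Y) has_vector_derivative sylv A (- ?L)) (at 0)"
    using has_vector_derivative_sylv[of ?a 0 Z "\<lambda>_. Y" 0] inj a by simp
  then have "((\<lambda>t. trace (sylv (?a t) Y ** X) / 2) has_vector_derivative
      trace (sylv A (- ?L) ** X) / 2) (at 0)"
    by (intro has_vector_derivative_divide bounded_linear.has_vector_derivative[OF bounded_linear_trace]
        bounded_linear.has_vector_derivative[OF matrix_mult.bounded_linear_left])
  moreover have "trace (sylv A (- ?L) ** X) = - trace (?L ** sylv A X)"
    using trace_lyapunov_swap[of "sylv A (- ?L)" A "sylv A X"]
    by (simp add: lyapunov_sylv[OF inj] matrix_mult.minus_left trace_minus)
  ultimately have der: "((\<lambda>t. trace (sylv (?a t) Y ** X) / 2) has_real_derivative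
      - trace (?L ** sylv A X) / 2) (at 0)"
    by (simp add: has_real_derivative_iff_has_vector_derivative)
  \<comment> \<open>The trace formula is only known where the Sylvester operator is injective, hence
    for \<open>t\<close> near 0; agreement there, including at 0, determines the derivative.\<close>
  have "(?a \<longlongrightarrow> ?a 0) (nhds 0)"
    using a has_vector_derivative_continuous continuous_at_imp_continuous_within isCont_def
      tendsto_at_iff_tendsto_nhds by blast
  then have "\<forall>\<^sub>F t in nhds 0. inj (lyapunov (?a t))"
    using eventually_inj_lyapunov[of "?a 0"] inj by simp
  moreover have Sym: "?a t \<in> Sym" for t
    using SPD_imp_Sym[OF A] Z by (simp add: Sym_iff transpose_add transpose_scalar)
  ultimately have "\<forall>\<^sub>F t in nhds 0. wasserstein_metric (?a t) X Y = trace (sylv (?a t) Y ** X) / 2"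
    by (elim eventually_mono) (rule wasserstein_metric_eq_trace[OF _ Sym X Y])
  then have "((\<lambda>t. wasserstein_metric (?a t) X Y) has_real_derivative
      - trace (?L ** sylv A X) / 2) (at 0)"
    using der by (subst DERIV_cong_ev) (auto)
  then show ?thesis
    unfolding metric_deriv_def by (rule DERIV_imp_deriv)
qed

text \<open>For symmetric \<open>L = sylv A W\<close> the squared length of \<open>W\<close> is the
  congruence trace of \<open>L\<close>, so its vanishing forces \<open>L = 0\<close> and then
  \<open>W = 0\<close>.\<close>

lemma wasserstein_metric_nondegenerate:
  assumes "A \<in> SPD" "W \<in> Sym" "wasserstein_metric A W W = 0"
  shows "W = 0"
proof -
  note inj = inj_lyapunov_SPD[OF assms(1)]
  have "transpose (sylv A W) = sylv A W"
    using sylv_Sym[OF inj SPD_imp_Sym] assms by (simp add: Sym_iff)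
  then have "sylv A W = 0"
    using trace_congruence_pos[OF assms(1), of "sylv A W"] assms(3)
    by (auto simp: wasserstein_metric_def)
  then show ?thesis
    using lyapunov_sylv[OF inj, of W] by (simp add: lyapunov.zero_right)
qed

text \<open>Every term of Koszul's formula is a trace against \<open>Q = sylv A Z\<close>, and
  comparison gives \<open>w = lyapunov A (L ** L) - lyapunov V L\<close>. Inserting V = AL + LA
  cancels all but -2LAL. The diagonal is the part that enters the geodesic equation.\<close>

lemma christoffel_wasserstein:
  assumes A: "A \<in> SPD" and V: "V \<in> Sym"
  shows "christoffel Sym wasserstein_metric A V V
    = - (2 *\<^sub>R (sylv A V ** A ** sylv A V))"
proof -
  note inj = inj_lyapunov_SPD[OF A]
  define L where "L = sylv A V"
  define w where "w = - (2 *\<^sub>R (L ** A ** L))"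
  have A': "A \<in> Sym" and L: "L \<in> Sym"
    using A V sylv_Sym[OF inj] by (auto simp: SPD_imp_Sym L_def)
  then have w: "w \<in> Sym"
    by (simp add: w_def Sym_iff transpose_minus transpose_scalar matrix_transpose_mul matrix_mul_assoc)
  have V_eq: "V = A ** L + L ** A"
    using lyapunov_sylv[OF inj, of V] by (simp add: L_def lyapunov_def)
  have koszul: "wasserstein_metric A w Z =
      (metric_deriv wasserstein_metric A V V Z + metric_deriv wasserstein_metric A V V Z
        - metric_deriv wasserstein_metric A Z V V) / 2" if Z: "Z \<in> Sym" for Z
  proof -
    define Q where "Q = sylv A Z"
    have Z_eq: "Z = lyapunov A Q"
      using lyapunov_sylv[OF inj, of Z] by (simp add: Q_def)
    have 1: "metric_deriv wasserstein_metric A V V Z = - trace (Q ** lyapunov V L) / 2"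
      using metric_deriv_wasserstein[OF A V V Z] trace_lyapunov_swap[of Q V L]
      by (simp add: L_def Q_def)
    have "trace (lyapunov Z L ** L) = 2 * trace (Z ** (L ** L))"
      using trace_mul_sym[of L "Z ** L"] by (simp add: lyapunov_def matrix_ring_simps trace_add)
    then have "metric_deriv wasserstein_metric A Z V V = - trace (Z ** (L ** L))"
      using metric_deriv_wasserstein[OF A Z V V] by (simp add: L_def)
    also have "\<dots> = - trace (Q ** lyapunov A (L ** L))"
      by (simp add: Z_eq trace_lyapunov_swap)
    finally have 2: "metric_deriv wasserstein_metric A Z V V = - trace (Q ** lyapunov A (L ** L))" .
    have "w = lyapunov A (L ** L) - lyapunov V L"
      by (simp add: w_def V_eq lyapunov_def matrix_ring_simps scaleR_2)
    then have "trace (Q ** w) = trace (Q ** lyapunov A (L ** L)) - trace (Q ** lyapunov V L)"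
      by (simp only: matrix_mult.diff_right trace_sub)
    moreover have "wasserstein_metric A w Z = trace (Q ** w) / 2"
      using wasserstein_metric_eq_trace[OF inj A' w Z] by (simp add: Q_def)
    ultimately show ?thesis
      by (simp add: 1 2 field_simps)
  qed
  show ?thesis
    unfolding christoffel_def L_def[symmetric] w_def[symmetric]
  proof (rule the_equality)
    fix w'
    assume w': "w' \<in> Sym \<and> (\<forall>z\<in>Sym. wasserstein_metric A w' z =
      (metric_deriv wasserstein_metric A V V z + metric_deriv wasserstein_metric A V V z
        - metric_deriv wasserstein_metric A z V V) / 2)"
    \<comment> \<open>Uniqueness for the definite description: test both Koszul equations against
      \<open>z = w' - w\<close>.\<close>
    have d: "w' - w \<in> Sym"
      using w w' by (simp add: Sym_iff transpose_diff)
    have "wasserstein_metric A (w' - w) (w' - w)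
        = wasserstein_metric A w' (w' - w) - wasserstein_metric A w (w' - w)"
      using wasserstein_metric_eq_trace[OF inj A' d d] wasserstein_metric_eq_trace[OF inj A' w d]
        wasserstein_metric_eq_trace[OF inj A' conjunct1[OF w'] d]
      by (simp only: matrix_mult.diff_right trace_sub diff_divide_distrib)
    also have "\<dots> = 0"
      using koszul[OF d] bspec[OF conjunct2[OF w'] d] by simp
    finally show "w' = w"
      using wasserstein_metric_nondegenerate[OF A d] by simp
  qed (use koszul w in auto)
qed

section \<open>Uniqueness for linear differential equations\<close>

text \<open>Gronwall's argument: the weight \<open>exp (- (2 * K * s))\<close> makes the squared
  norm of \<open>D\<close> nonincreasing, while it starts at 0 and is never negative. The square
  keeps it differentiable at zeros of \<open>D\<close>.\<close>

lemma zero_of_linear_growth: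
  fixes D :: "real \<Rightarrow> 'a::real_inner"
  assumes der: "\<And>t. t \<in> {0..b} \<Longrightarrow> (D has_vector_derivative D' t) (at t)"
    and bound: "\<And>t. t \<in> {0..b} \<Longrightarrow> norm (D' t) \<le> K * norm (D t)"
    and "D 0 = 0" and t: "t \<in> {0..b}"
  shows "D t = 0"
proof -
  define f where "f s = (D s \<bullet> D s) * exp (- (2 * K * s))" for s
  have "\<exists>y. DERIV f s :> y \<and> y \<le> 0" if "0 \<le> s" "s \<le> t" for s
  proof -
    have s: "s \<in> {0..b}"
      using that t by auto
    have "((\<lambda>s. D s \<bullet> D s) has_vector_derivative (D s \<bullet> D' s + D' s \<bullet> D s)) (at s)"
      by (intro bounded_bilinear.has_vector_derivative[OF bounded_bilinear_inner] der s)
    then have "((\<lambda>s. D s \<bullet> D s) has_real_derivative 2 * (D s \<bullet> D' s)) (at s)"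
      by (simp add: has_real_derivative_iff_has_vector_derivative inner_commute)
    moreover have "((\<lambda>s. exp (- (2 * K * s))) has_real_derivative
        exp (- (2 * K * s)) * - (2 * K)) (at s)"
      by (auto intro!: derivative_eq_intros)
    ultimately have "DERIV f s :> 2 * (D s \<bullet> D' s) * exp (- (2 * K * s))
        + exp (- (2 * K * s)) * - (2 * K) * (D s \<bullet> D s)"
      unfolding f_def by (rule DERIV_mult)
    then have "DERIV f s :> 2 * (D s \<bullet> D' s - K * (D s \<bullet> D s)) * exp (- (2 * K * s))"
      by (simp add: algebra_simps)
    moreover have "D s \<bullet> D' s \<le> K * (D s \<bullet> D s)"
    proof -
      have "D s \<bullet> D' s \<le> norm (D s) * norm (D' s)"
        by (rule norm_cauchy_schwarz)
      also have "\<dots> \<le> norm (D s) * (K * norm (D s))"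
        by (intro mult_left_mono bound s) auto
      finally show ?thesis
        by (metis dot_square_norm mult.left_commute power2_eq_square)
    qed
    then have "2 * (D s \<bullet> D' s - K * (D s \<bullet> D s)) * exp (- (2 * K * s)) \<le> 0"
      by (simp add: mult_le_0_iff)
    ultimately show ?thesis
      by (intro exI conjI)
  qed
  then have "f t \<le> f 0"
    using t by (intro DERIV_nonpos_imp_nonincreasing[of 0 t f]) simp_all
  then have "D t \<bullet> D t \<le> 0"
    using \<open>D 0 = 0\<close> by (simp add: f_def mult_le_0_iff)
  then show ?thesis
    by (metis inner_eq_zero_iff inner_ge_zero order_antisym)
qed

text \<open>Continuous coefficients are bounded on the compact interval, so \<open>D\<close> has
  linear growth with constant \<open>(p + q) * K\<close>.\<close>

lemma matrix_linear_ode_zero: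
  fixes D P Q :: "real \<Rightarrow> real^'n^'n"
  assumes der: "\<And>t. t \<in> {0..b} \<Longrightarrow> (D has_vector_derivative P t ** D t + D t ** Q t) (at t)"
    and P: "continuous_on {0..b} P" and Q: "continuous_on {0..b} Q"
    and "D 0 = 0" and t: "t \<in> {0..b}"
  shows "D t = 0"
proof -
  obtain K where K: "K > 0" "\<And>(A :: real^'n^'n) (B :: real^'n^'n). norm (A ** B) \<le> norm A * norm B * K"
    using matrix_mult.pos_bounded by blast
  obtain p where p: "\<And>t. t \<in> {0..b} \<Longrightarrow> norm (P t) \<le> p"
    using compact_imp_bounded[OF compact_continuous_image[OF P compact_Icc]]
    by (metis bounded_iff imageI)
  obtain q where q: "\<And>t. t \<in> {0..b} \<Longrightarrow> norm (Q t) \<le> q"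
    using compact_imp_bounded[OF compact_continuous_image[OF Q compact_Icc]]
    by (metis bounded_iff imageI)
  have "norm (P s ** D s + D s ** Q s) \<le> ((p + q) * K) * norm (D s)" if s: "s \<in> {0..b}" for s
  proof -
    have "norm (P s ** D s) \<le> norm (P s) * norm (D s) * K" by (rule K)
    also have "\<dots> \<le> p * norm (D s) * K"
      using K(1) p[OF s] by (intro mult_right_mono) auto
    finally have 1: "norm (P s ** D s) \<le> p * norm (D s) * K" .
    have "norm (D s ** Q s) \<le> norm (D s) * norm (Q s) * K" by (rule K)
    also have "\<dots> \<le> norm (D s) * q * K"
      using K(1) q[OF s] by (intro mult_right_mono mult_left_mono) auto
    finally have 2: "norm (D s ** Q s) \<le> norm (D s) * q * K" .
    show ?thesis
      using norm_triangle_ineq[of "P s ** D s" "D s ** Q s"] 1 2 by (simp add: algebra_simps)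
  qed
  with der show ?thesis
    using \<open>D 0 = 0\<close> t by (rule zero_of_linear_growth)
qed

section \<open>Geodesics, the Riccati equation and uniqueness\<close>

text \<open>Differentiating \<open>sylv (\<gamma> t) (v t)\<close> gives \<open>sylv\<close> of
  2L\<gamma>L - (vL + Lv). With v = \<gamma>L + L\<gamma> this argument equals
  \<open>- lyapunov (\<gamma> t) (L t ** L t)\<close>, so L' = -LL.\<close>

lemma geodesic_riccati:
  assumes geo: "geodesic_on Sym SPD wasserstein_metric I \<gamma>" and I: "open I"
    and der0: "0 \<in> I" "(\<gamma> has_vector_derivative X) (at 0)"
  obtains L where "L 0 = sylv (\<gamma> 0) X"
    "\<And>t. t \<in> I \<Longrightarrow> (\<gamma> has_vector_derivative L t ** \<gamma> t + \<gamma> t ** L t) (at t)"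
    "\<And>t. t \<in> I \<Longrightarrow> (L has_vector_derivative - (L t ** L t)) (at t)"
proof -
  obtain v where v: "\<And>t. t \<in> I \<Longrightarrow> (\<gamma> has_vector_derivative v t) (at t)"
    "\<And>t. t \<in> I \<Longrightarrow> (v has_vector_derivative
      - christoffel Sym wasserstein_metric (\<gamma> t) (v t) (v t)) (at t)"
    and SPD: "\<And>t. t \<in> I \<Longrightarrow> \<gamma> t \<in> SPD"
    using geo unfolding geodesic_on_def by blast
  note inj = inj_lyapunov_SPD[OF SPD]
  \<comment> \<open>The curve stays symmetric, so its velocity equals its own transpose; the
    Christoffel formula requires this.\<close>
  have Sym: "v t \<in> Sym" if t: "t \<in> I" for t
  proof -
    have "((\<lambda>t. transpose (\<gamma> t)) has_vector_derivative transpose (v t)) (at t)"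
      by (intro bounded_linear.has_vector_derivative[OF bounded_linear_transpose] v t)
    then have "(\<gamma> has_vector_derivative transpose (v t)) (at t)"
      by (rule has_vector_derivative_transform_within_open[OF _ I t])
        (use SPD_imp_Sym[OF SPD] in \<open>simp add: Sym_iff\<close>)
    from vector_derivative_unique_at[OF v(1)[OF t] this] show ?thesis
      by (simp add: Sym_iff)
  qed
  define L where "L t = sylv (\<gamma> t) (v t)" for t
  have v_eq: "v t = \<gamma> t ** L t + L t ** \<gamma> t" if "t \<in> I" for t
    using lyapunov_sylv[OF inj[OF that], of "v t"] by (simp add: L_def lyapunov_def)
  have "(L has_vector_derivative - (L t ** L t)) (at t)" if t: "t \<in> I" for t
  proof -
    have "(v has_vector_derivative 2 *\<^sub>R (L t ** \<gamma> t ** L t)) (at t)"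
      using v(2)[OF t] by (simp add: christoffel_wasserstein[OF SPD[OF t] Sym[OF t]] L_def)
    then have "(L has_vector_derivative
        sylv (\<gamma> t) (2 *\<^sub>R (L t ** \<gamma> t ** L t) - lyapunov (v t) (L t))) (at t)"
      unfolding L_def by (rule has_vector_derivative_sylv[OF inj[OF t] v(1)[OF t]])
    moreover have "sylv (\<gamma> t) (2 *\<^sub>R (L t ** \<gamma> t ** L t) - lyapunov (v t) (L t)) = - (L t ** L t)"
      by (rule sylv_eqI[OF inj[OF t]])
        (simp add: v_eq[OF t] lyapunov_def matrix_ring_simps scaleR_2)
    ultimately show ?thesis
      by simp
  qed
  moreover have "(\<gamma> has_vector_derivative L t ** \<gamma> t + \<gamma> t ** L t) (at t)" if "t \<in> I" for t
    using v(1)[OF that] v_eq[OF that] by (simp add: add.commute)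
  moreover have "L 0 = sylv (\<gamma> 0) X"
    using vector_derivative_unique_at[OF v(1)[OF der0(1)] der0(2)] by (simp add: L_def)
  ultimately show ?thesis
    by (intro that)
qed

lemma continuous_on_of_has_vector_derivative:
  assumes "\<And>t. t \<in> S \<Longrightarrow> (f has_vector_derivative f' t) (at t)"
  shows "continuous_on S f"
  using assms has_vector_derivative_continuous continuous_at_imp_continuous_on by blast

lemma wasserstein_exp_rel_unique:
  assumes "riem_exp_rel Sym SPD wasserstein_metric A X p"
    and "riem_exp_rel Sym SPD wasserstein_metric A X q"
  shows "p = q"
proof -
  \<comment> \<open>The two geodesics may live on different intervals; both contain the unit
    interval, where they are compared.\<close>
  have sub: "\<exists>\<gamma> L. \<gamma> 0 = A \<and> \<gamma> 1 = p \<and> L 0 = sylv A X \<and>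
      (\<forall>t\<in>{0..1::real}. (\<gamma> has_vector_derivative L t ** \<gamma> t + \<gamma> t ** L t) (at t) \<and>
        (L has_vector_derivative - (L t ** L t)) (at t))"
    if rel: "riem_exp_rel Sym SPD wasserstein_metric A X p" for p
  proof -
    obtain I \<gamma> where \<gamma>: "open I" "is_interval I" "{0, 1} \<subseteq> I"
      "geodesic_on Sym SPD wasserstein_metric I \<gamma>"
      "\<gamma> 0 = A" "(\<gamma> has_vector_derivative X) (at 0)" "\<gamma> 1 = p"
      using rel unfolding riem_exp_rel_def by (elim exE conjE)
    have I01: "0 \<in> I" "1 \<in> I"
      using \<gamma>(3) by simp_all
    have "{0..1} \<subseteq> I"
      using \<gamma>(2) I01 unfolding is_interval_1 by (meson atLeastAtMost_iff subsetI)
    moreover obtain L where "L 0 = sylv (\<gamma> 0) X"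
      "\<And>t. t \<in> I \<Longrightarrow> (\<gamma> has_vector_derivative L t ** \<gamma> t + \<gamma> t ** L t) (at t)"
      "\<And>t. t \<in> I \<Longrightarrow> (L has_vector_derivative - (L t ** L t)) (at t)"
      by (fact geodesic_riccati[OF \<gamma>(4,1) I01(1) \<gamma>(6)])
    ultimately show ?thesis
      using \<gamma>(5,7) by (intro exI[of _ \<gamma>] exI[of _ L]) auto
  qed
  obtain \<gamma>1 L1 where 1: "\<gamma>1 0 = A" "\<gamma>1 1 = p" "L1 0 = sylv A X"
      "\<And>t. t \<in> {0..1::real} \<Longrightarrow> (\<gamma>1 has_vector_derivative L1 t ** \<gamma>1 t + \<gamma>1 t ** L1 t) (at t)"
      "\<And>t. t \<in> {0..1::real} \<Longrightarrow> (L1 has_vector_derivative - (L1 t ** L1 t)) (at t)"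
    using sub[OF assms(1)] by blast
  obtain \<gamma>2 L2 where 2: "\<gamma>2 0 = A" "\<gamma>2 1 = q" "L2 0 = sylv A X"
      "\<And>t. t \<in> {0..1::real} \<Longrightarrow> (\<gamma>2 has_vector_derivative L2 t ** \<gamma>2 t + \<gamma>2 t ** L2 t) (at t)"
      "\<And>t. t \<in> {0..1::real} \<Longrightarrow> (L2 has_vector_derivative - (L2 t ** L2 t)) (at t)"
    using sub[OF assms(2)] by blast
  have cont: "continuous_on {0..1} L1" "continuous_on {0..1} L2"
    by (rule continuous_on_of_has_vector_derivative, erule 1 2)+
  \<comment> \<open>The Riccati equation does not involve the curve, so \<open>L\<close> is settled
    first. The difference of squares splits as L1(L1 - L2) + (L1 - L2)L2, which is linear in L1 -
    L2.\<close>
  have L_eq: "L1 t = L2 t" if "t \<in> {0..1}" for t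
  proof -
    have "((\<lambda>t. L1 t - L2 t) has_vector_derivative
        (- L1 s) ** (L1 s - L2 s) + (L1 s - L2 s) ** (- L2 s)) (at s)" if "s \<in> {0..1}" for s
      using has_vector_derivative_diff[OF 1(5)[OF that] 2(5)[OF that]]
      by (simp add: matrix_ring_simps)
    then have "L1 t - L2 t = 0"
      by (rule matrix_linear_ode_zero)
         (use cont 1(3) 2(3) that in \<open>auto intro: continuous_on_minus\<close>)
    then show ?thesis
      by simp
  qed
  \<comment> \<open>With a common \<open>L\<close>, the curves solve one and the same linear
    equation.\<close>
  have "((\<lambda>t. \<gamma>1 t - \<gamma>2 t) has_vector_derivative
      L1 s ** (\<gamma>1 s - \<gamma>2 s) + (\<gamma>1 s - \<gamma>2 s) ** L1 s) (at s)" if "s \<in> {0..1}" for s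
    using has_vector_derivative_diff[OF 1(4)[OF that] 2(4)[OF that]] L_eq[OF that]
    by (simp add: matrix_ring_simps algebra_simps)
  then have "\<gamma>1 1 - \<gamma>2 1 = 0"
    by (rule matrix_linear_ode_zero) (use cont 1(1) 2(1) in auto)
  then show ?thesis
    using 1(2) 2(2) by simp
qed

section \<open>The explicit geodesic\<close>

lemma SPD_congruence:
  assumes "A \<in> SPD" "S \<in> Sym" "invertible S"
  shows "S ** A ** S \<in> SPD"
proof -
  have [simp]: "transpose A = A" "transpose S = S"
    using assms SPD_imp_Sym by (auto simp: Sym_iff)
  have "0 < x \<bullet> ((S ** A ** S) *v x)" if "x \<noteq> 0" for x
  proof -
    have "S *v x \<noteq> 0"
      using assms(3) that invertible_left_inverse matrix_left_invertible_ker by blast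
    then have "0 < (S *v x) \<bullet> (A *v (S *v x))"
      using assms(1) by (simp add: SPD_def)
    also have "\<dots> = x \<bullet> (S *v (A *v (S *v x)))"
      by (metis \<open>transpose S = S\<close> dot_lmul_matrix vector_transpose_matrix)
    finally show ?thesis
      by (simp add: matrix_vector_mul_assoc matrix_mul_assoc)
  qed
  then show ?thesis
    by (auto simp: SPD_def Sym_iff matrix_transpose_mul matrix_mul_assoc)
qed

text \<open>The curve factors as SAS with S = 1 + tG, which keeps it in \<open>SPD\<close>; the
  expanded polynomial has the evident second derivative 2GAG. It remains to identify L\<gamma>L with
  GAG.\<close>

lemma wasserstein_geodesic:
  fixes A G :: "real^'n^'n"
  assumes A: "A \<in> SPD" and G: "G \<in> Sym"
    and inv: "\<And>t. t \<in> I \<Longrightarrow> invertible (mat 1 + t *\<^sub>R G)"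
  shows "geodesic_on Sym SPD wasserstein_metric I
    (\<lambda>t. A + t *\<^sub>R lyapunov A G + t\<^sup>2 *\<^sub>R (G ** A ** G))"
    (is "geodesic_on _ _ _ _ ?\<gamma>")
proof -
  let ?v = "\<lambda>t. lyapunov A G + (2 * t) *\<^sub>R (G ** A ** G)"
  have [simp]: "transpose A = A" "transpose G = G"
    using A G SPD_imp_Sym by (auto simp: Sym_iff)
  define S where "S t = mat 1 + t *\<^sub>R G" for t
  have S: "S t \<in> Sym" for t
    by (simp add: S_def Sym_iff transpose_add transpose_scalar)
  have \<gamma>_eq: "?\<gamma> t = S t ** A ** S t" for t
    by (simp add: S_def lyapunov_def matrix_ring_simps algebra_simps power2_eq_square)
  have v_eq: "?v t = G ** A ** S t + S t ** A ** G" for t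
    by (simp add: S_def lyapunov_def matrix_ring_simps algebra_simps scaleR_add_left[symmetric])
  have SPD: "?\<gamma> t \<in> SPD" if "t \<in> I" for t
    unfolding \<gamma>_eq using inv[OF that] by (intro SPD_congruence A S) (simp add: S_def)
  have "(?v has_vector_derivative - christoffel Sym wasserstein_metric (?\<gamma> t) (?v t) (?v t)) (at t)"
    if t: "t \<in> I" for t
  proof -
    obtain R where R: "S t ** R = mat 1" "R ** S t = mat 1"
      using inv[OF t] by (auto simp: invertible_def S_def)
    \<comment> \<open>The Riccati solution is the inverse of S times G. As S commutes with G, both
      SL and LS equal G, which collapses all products with SAS.\<close>
    define L where "L = R ** G"
    have SL: "S t ** L = G"
      by (simp add: L_def matrix_mul_assoc R)
    have "S t ** G = G ** S t"
      by (simp add: S_def matrix_ring_simps)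
    then have "L ** S t = R ** (S t ** G)"
      by (simp add: L_def matrix_mul_assoc[symmetric])
    then have LS: "L ** S t = G"
      by (simp add: matrix_mul_assoc R)
    have LSM: "L ** (S t ** M) = G ** M" for M
      by (simp add: matrix_mul_assoc LS)
    have "lyapunov (?\<gamma> t) L = ?v t"
      unfolding \<gamma>_eq v_eq
      by (simp add: lyapunov_def matrix_mul_assoc[symmetric] SL LSM add.commute)
    then have "sylv (?\<gamma> t) (?v t) = L"
      by (rule sylv_eqI[OF inj_lyapunov_SPD[OF SPD[OF t]]])
    moreover have "L ** ?\<gamma> t ** L = G ** A ** G"
      unfolding \<gamma>_eq by (simp add: matrix_mul_assoc[symmetric] SL LSM)
    moreover have "?v t \<in> Sym"
      using S[of t] by (simp add: v_eq Sym_iff transpose_add matrix_transpose_mul matrix_mul_assoc add.commute)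
    ultimately have "- christoffel Sym wasserstein_metric (?\<gamma> t) (?v t) (?v t) = 2 *\<^sub>R (G ** A ** G)"
      using christoffel_wasserstein[OF SPD[OF t]] by simp
    then show ?thesis
      by (auto intro!: derivative_eq_intros)
  qed
  moreover have "(?\<gamma> has_vector_derivative ?v t) (at t)" for t
    by (auto intro!: derivative_eq_intros simp: scaleR_add_left[symmetric])
  ultimately show ?thesis
    unfolding geodesic_on_def using SPD by (intro conjI ballI exI[of _ ?v])
qed

section \<open>The exponential map on a small ball\<close>

text \<open>The determinant is continuous and equals 1 at the identity.\<close>

lemma invertible_near_mat_1:
  obtains \<delta> where "\<delta> > 0" "\<And>M :: real^'n^'n. norm M < \<delta> \<Longrightarrow> invertible (mat 1 + M)"
proof -
  have "open {N :: real^'n^'n. det N \<noteq> 0}"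
    unfolding det_def by (intro open_Collect_neq continuous_intros)
  then obtain \<delta> where \<delta>: "\<delta> > 0" "ball (mat 1) \<delta> \<subseteq> {N :: real^'n^'n. det N \<noteq> 0}"
    using open_contains_ball by (metis (mono_tags) det_I mem_Collect_eq zero_neq_one)
  show ?thesis
  proof (rule that[OF \<delta>(1)])
    fix M :: "real^'n^'n"
    assume "norm M < \<delta>"
    then have "mat 1 + M \<in> ball (mat 1) \<delta>"
      by (simp add: dist_norm)
    then show "invertible (mat 1 + M)"
      using \<delta>(2) by (auto simp: invertible_det_nz)
  qed
qed

theorem theorem3p5:
  fixes A :: "real ^ 'n ^ 'n"
  assumes "A \<in> SPD"
  shows "\<exists>\<epsilon>>0.
           ball 0 \<epsilon> \<inter> Sym \<subseteq> wasserstein_exp_domain A \<and>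
           wasserstein_exp A ` (ball 0 \<epsilon> \<inter> Sym) \<subseteq> SPD \<and>
           (\<forall>X \<in> ball 0 \<epsilon> \<inter> Sym.
              wasserstein_exp A X = A + X + sylv A X ** A ** sylv A X)"
proof -
  note inj = inj_lyapunov_SPD[OF assms]
  obtain \<delta> where \<delta>: "\<delta> > 0" "\<And>M :: real^'n^'n. norm M < \<delta> \<Longrightarrow> invertible (mat 1 + M)"
    using invertible_near_mat_1 by blast
  obtain C where C: "C > 0" "\<And>X. norm (sylv A X) \<le> norm X * C"
    using bounded_linear.pos_bounded[OF linear_sylv[OF inj, unfolded linear_conv_bounded_linear]]
    by blast
  \<comment> \<open>This makes the norm of \<open>sylv A X\<close> smaller than
    \<open>\<delta> / 2\<close>, so 1 + tG stays invertible for \<bar>t\<bar> \<le> 2. That leaves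
    room for an open interval around both 0 and 1.\<close>
  define \<epsilon> where "\<epsilon> = \<delta> / (2 * C)"
  let ?E = "\<lambda>X. A + X + sylv A X ** A ** sylv A X"
  have main: "riem_exp_rel Sym SPD wasserstein_metric A X (?E X) \<and> ?E X \<in> SPD"
    if X: "X \<in> ball 0 \<epsilon> \<inter> Sym" for X
  proof -
    let ?G = "sylv A X"
    let ?\<gamma> = "\<lambda>t. A + t *\<^sub>R lyapunov A ?G + t\<^sup>2 *\<^sub>R (?G ** A ** ?G)"
    have "norm X * C < \<delta> / 2"
      using X C(1) by (simp add: \<epsilon>_def field_simps)
    then have small: "norm ?G < \<delta> / 2"
      using C(2)[of X] by linarith
    have "invertible (mat 1 + t *\<^sub>R ?G)" if "t \<in> {-1<..<2}" for t
    proof (rule \<delta>(2))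
      have "\<bar>t\<bar> * norm ?G \<le> 2 * norm ?G"
        using that by (intro mult_right_mono) auto
      then show "norm (t *\<^sub>R ?G) < \<delta>"
        using small by simp
    qed
    moreover have "?G \<in> Sym"
      using X sylv_Sym[OF inj SPD_imp_Sym[OF assms]] by simp
    ultimately have geo: "geodesic_on Sym SPD wasserstein_metric {-1<..<2} ?\<gamma>"
      by (intro wasserstein_geodesic assms)
    have "(?\<gamma> has_vector_derivative X) (at 0)"
      by (auto intro!: derivative_eq_intros simp: lyapunov_sylv[OF inj])
    moreover have \<gamma>1: "?\<gamma> 1 = ?E X"
      by (simp add: lyapunov_sylv[OF inj])
    ultimately have "riem_exp_rel Sym SPD wasserstein_metric A X (?E X)"
      unfolding riem_exp_rel_def using geo
      by (intro exI[of _ "{-1<..<2}"] exI[of _ ?\<gamma>]) (auto simp: is_interval_1)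
    moreover have "?\<gamma> 1 \<in> SPD"
      using geo[unfolded geodesic_on_def, THEN conjunct1, THEN bspec, of 1] by simp
    ultimately show ?thesis
      using \<gamma>1 by simp
  qed
  \<comment> \<open>Existence comes from the explicit geodesic; uniqueness of the endpoint makes the
    definite description denote it.\<close>
  have exp: "wasserstein_exp A X = ?E X" if "X \<in> ball 0 \<epsilon> \<inter> Sym" for X
    unfolding riem_exp_def using main[OF that] wasserstein_exp_rel_unique
    by (intro the_equality) blast+
  moreover have "\<epsilon> > 0"
    using \<delta>(1) C(1) by (simp add: \<epsilon>_def)
  moreover have "ball 0 \<epsilon> \<inter> Sym \<subseteq> wasserstein_exp_domain A"
    unfolding riem_exp_domain_def using main by blast
  moreover have "wasserstein_exp A ` (ball 0 \<epsilon> \<inter> Sym) \<subseteq> SPD"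
    using main exp by (intro image_subsetI) (simp only:)
  ultimately show ?thesis
    by blast
qed

end
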